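(* Let $\mathcal I$ be a finite set of images, let $g$ be a symmetric nonnegative similarity function on pairs of images in $\mathcal I$, and let $h(\mathcal V)=\mathrm{Rep}(\mathcal V)-\mathrm{Red}(\mathcal V)$ for $\mathcal V\subseteq\mathcal I$, where $\mathrm{Rep}$ and $\mathrm{Red}$ are the visual representativeness and visual redundancy of a view set. Then $h$ is a submodular function; that is, for every $\mathcal V\subseteq\mathcal I$, all $\mathcal V_1\subseteq\mathcal V_2\subseteq\mathcal V$ and all $v_j\in\mathcal I$ with $v_j\notin\mathcal V$, $$h(\mathcal V_1\cup\{v_j\})-h(\mathcal V_1)\ \geq\ h(\mathcal V_2\cup\{v_j\})-h(\mathcal V_2).$$
   Context: $\mathcal I=\{\mathcal I_n\}_{n=1}^N$ is the finite set of the $N$ database images; its elements, when regarded as views, are written $v_i$. A view set is a subset $\mathcal V\subseteq\mathcal I$. The function $g$ measures the feature similarity of two image views, and $g_{ij}=g(v_i,v_j)$; it is symmetric ($g_{ij}=g_{ji}$) and nonnegative ($g_{ij}\ge 0$). The visual representativeness of $\mathcal V$ is $$\mathrm{Rep}(\mathcal V)=\sum_{v_i\in\mathcal V}\ \sum_{v_j\in\mathcal I,\ j\neq i} g_{ij}.$$ The visual redundancy of $\mathcal V$ is $$\mathrm{Red}(\mathcal V)=\sum_{v_i,v_j\in\mathcal V,\ i\neq j} g_{ij},$$ where the sum is over ordered pairs. *)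

theory Defs
  imports Complex_Main
begin

definition visual_rep :: "('a \<Rightarrow> 'a \<Rightarrow> real) \<Rightarrow> 'a set \<Rightarrow> 'a set \<Rightarrow> real" where
  "visual_rep g I V = (\<Sum>u\<in>V. \<Sum>w\<in>I - {u}. g u w)"

(* Ordered pairs: each unordered pair of distinct views contributes both g u w and g w u. *)
definition visual_red :: "('a \<Rightarrow> 'a \<Rightarrow> real) \<Rightarrow> 'a set \<Rightarrow> real" where
  "visual_red g V = (\<Sum>(u, w)\<in>{(u, w). u \<in> V \<and> w \<in> V \<and> u \<noteq> w}. g u w)"

definition submodular_on :: "'a set \<Rightarrow> ('a set \<Rightarrow> real) \<Rightarrow> bool" where
  "submodular_on I h \<longleftrightarrow>
    (\<forall>V V1 V2 v. V \<subseteq> I \<and> V1 \<subseteq> V2 \<and> V2 \<subseteq> V \<and> v \<in> I \<and> v \<notin> V \<longrightarrow>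
      h (V1 \<union> {v}) - h V1 \<ge> h (V2 \<union> {v}) - h V2)"

end

theory Submission
  imports Defs
begin

text \<open>Adding \<open>v\<close> to a view set changes \<open>h\<close> by a constant independent
  of the set (\<open>visual_rep_insert\<close>) minus the similarity between \<open>v\<close> and
  the set, counted in both directions (\<open>visual_red_insert\<close>). That similarity can only
  grow with the set, so the gain shrinks.\<close>

lemma visual_rep_insert:
  assumes "finite V" "v \<notin> V"
  shows "visual_rep g I (insert v V) = visual_rep g I V + (\<Sum>w\<in>I - {v}. g v w)"
  using assms by (simp add: visual_rep_def)

text \<open>The new ordered pairs are those with \<open>v\<close> in exactly one coordinate, so each
  old view enters twice.\<close>

lemma visual_red_insert:
  assumes fin: "finite V" and v: "v \<notin> V"
  shows "visual_red g (insert v V) = visual_red g V + (\<Sum>w\<in>V. g v w + g w v)"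
proof -
  let ?P = "\<lambda>V. {(u, w). u \<in> V \<and> w \<in> V \<and> u \<noteq> w}"
  have split: "?P (insert v V) = ?P V \<union> (Pair v ` V \<union> (\<lambda>w. (w, v)) ` V)"
    using v by auto
  have finP: "finite (?P V)"
    by (rule finite_subset[of _ "V \<times> V"]) (use fin in auto)
  \<comment> \<open>The three pieces are disjoint because \<open>v\<close> is not in
    \<open>V\<close>.\<close>
  have "visual_red g (insert v V) = visual_red g V
      + ((\<Sum>(u, w)\<in>Pair v ` V. g u w) + (\<Sum>(u, w)\<in>(\<lambda>w. (w, v)) ` V. g u w))"
    unfolding visual_red_def split
    using fin finP v by (subst sum.union_disjoint; (subst sum.union_disjoint)?) auto
  also have "(\<Sum>(u, w)\<in>Pair v ` V. g u w) = (\<Sum>w\<in>V. g v w)"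
    by (subst sum.reindex) (auto simp: inj_on_def)
  also have "(\<Sum>(u, w)\<in>(\<lambda>w. (w, v)) ` V. g u w) = (\<Sum>w\<in>V. g w v)"
    by (subst sum.reindex) (auto simp: inj_on_def)
  finally show ?thesis
    by (simp add: sum.distrib)
qed

text \<open>Representativeness is modular, so its marginal gains cancel; the marginal redundancy of a view
  is a sum of nonnegative terms over the view set and hence grows with it.\<close>

theorem lemma1:
  fixes I :: "'a set" and g :: "'a \<Rightarrow> 'a \<Rightarrow> real"
  assumes "finite I"
    and "\<And>u w. u \<in> I \<Longrightarrow> w \<in> I \<Longrightarrow> g u w = g w u"
    and "\<And>u w. u \<in> I \<Longrightarrow> w \<in> I \<Longrightarrow> g u w \<ge> 0"
  shows "submodular_on I (\<lambda>V. visual_rep g I V - visual_red g V)"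
  unfolding submodular_on_def
proof (intro allI impI, elim conjE)
  fix V V1 V2 v
  assume sub: "V \<subseteq> I" "V1 \<subseteq> V2" "V2 \<subseteq> V" and v: "v \<in> I" "v \<notin> V"
  have fin: "finite V1" "finite V2"
    using sub \<open>finite I\<close> by (meson finite_subset)+
  have notin: "v \<notin> V1" "v \<notin> V2"
    using sub v by auto
  \<comment> \<open>The extra terms, over \<open>V2 - V1\<close>, are nonnegative since
    \<open>v\<close> and all of \<open>V2\<close> lie in \<open>I\<close>.\<close>
  have "(\<Sum>w\<in>V1. g v w + g w v) \<le> (\<Sum>w\<in>V2. g v w + g w v)"
    using fin sub v by (intro sum_mono2 add_nonneg_nonneg assms(3)) auto
  then show "(visual_rep g I (V1 \<union> {v}) - visual_red g (V1 \<union> {v})) - (visual_rep g I V1 - visual_red g V1)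
      \<ge> (visual_rep g I (V2 \<union> {v}) - visual_red g (V2 \<union> {v})) - (visual_rep g I V2 - visual_red g V2)"
    using fin notin by (simp add: visual_rep_insert visual_red_insert)
qed

end
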